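(* Let $c(x)=\sum_{n=1}^\infty\phi_{C_n}x^n$ and $s(x)=\sum_{n=0}^\infty\phi_{S_n}\frac{x^n}{n!}$. Then, as formal power series over $\mathbb{Q}$, (a) $c(x)=\ln(1+x)$; (b) $s(x)=\dfrac{x}{e^x-1}$. In particular, $\phi_{C_n}=(-1)^{n-1}\frac1n$ for all $n\ge 1$, and $\phi_{S_n}=b_n$ for all $n\ge 0$, where $b_0,b_1,b_2,\ldots$ are the Bernoulli numbers defined by $\frac{x}{e^x-1}=\sum_{n=0}^\infty b_n\frac{x^n}{n!}$.
   Context: A rooted tree is a finite connected acyclic graph with a designated root $\mathrm{rt}_T$; isomorphisms preserve roots. $E(T)$ is the edge set and $v(T)$ the number of vertices. $C_n$ ($n\ge1$) is the chain: the rooted tree with $n$ vertices and height $n-1$. $S_n$ ($n\ge 0$) is the shrub: the rooted tree with $n+1$ vertices in which every non-root vertex is a child of the root ($S_0=C_1$ is the one-vertex tree). For $e\in E(T)$ let $T_e$ be the component of $T$ minus the edge $e$ containing $\mathrm{rt}_T$ (rooted at $\mathrm{rt}_T$), and $T'_e$ the other component, rooted at the endpoint of $e$ farther from $\mathrm{rt}_T$. Write $e\succ f$ if $f\in E(T_e)$; $e_1\succ\cdots\succ e_r$ means $e_i\succ e_j$ for all $i<j$. Such a sequence $\vec e$ determines rooted trees $T_{\vec e,1},\ldots,T_{\vec e,r+1}$: put $S^{(1)}=T$ and, for $i=1,\ldots,r$, $T_{\vec e,i}=(S^{(i)})'_{e_i}$, $S^{(i+1)}=(S^{(i)})_{e_i}$;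 finally $T_{\vec e,r+1}=S^{(r+1)}$. The rational numbers $\phi_T$ (depending only on the isomorphism class of $T$) are defined recursively by $\phi_T=1$ if $v(T)=1$ and, for $v(T)\ge2$, $$\phi_T=-\sum_{k=2}^{v(T)}\frac{1}{k!}\sum_{\substack{\vec e\in E(T)^{k-1}\\ e_1\succ\cdots\succ e_{k-1}}}\phi_{T_{\vec e,1}}\cdots\phi_{T_{\vec e,k}}.$$ *)

theory Defs
  imports "HOL-Computational_Algebra.Formal_Power_Series"
begin

section \<open>Rooted trees\<close>

text \<open>Simple undirected graphs with a marked vertex; an edge is the set of its two endpoints.\<close>

datatype 'a rooted_graph =
  Rooted_Graph (verts: "'a set") (edges: "'a set set") (root: 'a)

definition adj :: "'a set set \<Rightarrow> ('a \<times> 'a) set" where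
  "adj E = {(u, w). {u, w} \<in> E}"

definition is_cycle :: "'a set set \<Rightarrow> 'a list \<Rightarrow> bool" where
  "is_cycle E cs \<longleftrightarrow> length cs \<ge> 3 \<and> distinct cs \<and>
     (\<forall>i<length cs. {cs ! i, cs ! (Suc i mod length cs)} \<in> E)"

definition rooted_tree :: "'a rooted_graph \<Rightarrow> bool" where
  "rooted_tree T \<longleftrightarrow>
     finite (verts T) \<and>
     root T \<in> verts T \<and>
     (\<forall>e\<in>edges T. e \<subseteq> verts T \<and> card e = 2) \<and>
     (\<forall>u\<in>verts T. \<forall>w\<in>verts T. (u, w) \<in> (adj (edges T))\<^sup>*) \<and>
     \<not> (\<exists>cs. is_cycle (edges T) cs)"

text \<open>Graph distance from the root.\<close>

definition depth :: "'a rooted_graph \<Rightarrow> 'a \<Rightarrow> nat" where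
  "depth T w = (LEAST n. (root T, w) \<in> adj (edges T) ^^ n)"

definition height :: "'a rooted_graph \<Rightarrow> nat" where
  "height T = Max (depth T ` verts T)"

definition is_chain :: "nat \<Rightarrow> 'a rooted_graph \<Rightarrow> bool" where
  "is_chain n T \<longleftrightarrow> rooted_tree T \<and> card (verts T) = n \<and> height T = n - 1"

definition is_shrub :: "nat \<Rightarrow> 'a rooted_graph \<Rightarrow> bool" where
  "is_shrub n T \<longleftrightarrow> rooted_tree T \<and> card (verts T) = n + 1 \<and>
     (\<forall>w\<in>verts T - {root T}. {root T, w} \<in> edges T)"

section \<open>Cutting edges\<close>

text \<open>The component of \<open>T\<close> minus the edge \<open>e\<close> that contains the vertex \<open>x\<close>, rooted at \<open>x\<close>.\<close>

definition component_minus :: "'a rooted_graph \<Rightarrow> 'a set \<Rightarrow> 'a \<Rightarrow> 'a rooted_graph" where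
  "component_minus T e x =
     (let V = {w \<in> verts T. (x, w) \<in> (adj (edges T - {e}))\<^sup>*}
      in Rooted_Graph V {f \<in> edges T - {e}. f \<subseteq> V} x)"

definition far_end :: "'a rooted_graph \<Rightarrow> 'a set \<Rightarrow> 'a" where
  "far_end T e = (ARG_MAX (depth T) w. w \<in> e)"

text \<open>\<open>lower T e\<close> and \<open>upper T e\<close> are the trees usually written $T_e$ and $T'_e$.\<close>

definition lower :: "'a rooted_graph \<Rightarrow> 'a set \<Rightarrow> 'a rooted_graph" where
  "lower T e = component_minus T e (root T)"

definition upper :: "'a rooted_graph \<Rightarrow> 'a set \<Rightarrow> 'a rooted_graph" where
  "upper T e = component_minus T e (far_end T e)"

definition edge_succ :: "'a rooted_graph \<Rightarrow> 'a set \<Rightarrow> 'a set \<Rightarrow> bool" where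
  "edge_succ T e f \<longleftrightarrow> f \<in> edges (lower T e)"

text \<open>The sequences $(e_1,\dots,e_r)\in E(T)^r$ with $e_i\succ e_j$ for all $i<j$.\<close>

definition cut_seqs :: "'a rooted_graph \<Rightarrow> nat \<Rightarrow> 'a set list set" where
  "cut_seqs T r =
     {es. length es = r \<and> set es \<subseteq> edges T \<and> sorted_wrt (edge_succ T) es}"

text \<open>The list of the trees $T_{\vec e,1},\dots,T_{\vec e,r+1}$.\<close>

fun pieces :: "'a rooted_graph \<Rightarrow> 'a set list \<Rightarrow> 'a rooted_graph list" where
  "pieces T [] = [T]"
| "pieces T (e # es) = upper T e # pieces (lower T e) es"

lemma component_minus_simps:
  "verts (component_minus T e x) = {w \<in> verts T. (x, w) \<in> (adj (edges T - {e}))\<^sup>*}"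
  "edges (component_minus T e x) = {f \<in> edges T - {e}. f \<subseteq> verts (component_minus T e x)}"
  "root (component_minus T e x) = x"
  by (simp_all add: component_minus_def Let_def)

lemma sym_adj: "sym (adj E)"
  by (auto simp: sym_def adj_def insert_commute)

lemma tree_edge_is_bridge:
  assumes "rooted_tree T" "{u, w} \<in> edges T"
  shows "(u, w) \<notin> (adj (edges T - {{u, w}}))\<^sup>*"
proof
  let ?R = "adj (edges T - {{u, w}})"
  assume "(u, w) \<in> ?R\<^sup>*"
  then obtain m where ex: "(u, w) \<in> ?R ^^ m" by (auto simp: rtrancl_power)
  define n where "n = (LEAST n. (u, w) \<in> ?R ^^ n)"
  have n: "(u, w) \<in> ?R ^^ n" and least: "\<And>k. (u, w) \<in> ?R ^^ k \<Longrightarrow> n \<le> k"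
    unfolding n_def using ex by (auto intro: LeastI Least_le)
  obtain p where p: "p 0 = u" "p n = w" "\<And>i. i < n \<Longrightarrow> (p i, p (Suc i)) \<in> ?R"
    using n by (auto simp: relpow_fun_conv)
  have "card {u, w} = 2" using assms by (auto simp: rooted_tree_def)
  hence uw: "u \<noteq> w" by auto
  have seg: "(p i, p (i + k)) \<in> ?R ^^ k" if "i + k \<le> n" for i k
    using that by (induction k) (auto intro!: relcompI p(3))
  have inj: False if "i < j" "j \<le> n" "p i = p j" for i j
  proof -
    have "(u, p i) \<in> ?R ^^ i" using seg[of 0 i] that p by simp
    moreover have "(p i, w) \<in> ?R ^^ (n - j)" using seg[of j "n - j"] that p by simp
    ultimately have "(u, w) \<in> ?R ^^ (i + (n - j))" by (auto simp: relpow_add)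
    from least[OF this] that show False by simp
  qed
  define cs where "cs = map p [0..<Suc n]"
  have len: "length cs = Suc n" by (simp add: cs_def)
  have nth: "cs ! i = p i" if "i \<le> n" for i
    using that unfolding cs_def by (subst nth_map) (auto simp del: upt_Suc)
  have "n \<noteq> 0" using p uw by (intro notI) simp
  moreover have "n \<noteq> 1"
  proof
    assume "n = 1"
    thus False using p(1,2) p(3)[of 0] by (simp add: adj_def)
  qed
  ultimately have n2: "n \<ge> 2" by simp
  have "distinct cs"
    unfolding distinct_conv_nth len
  proof (intro allI impI)
    fix i j assume "i < Suc n" "j < Suc n" "i \<noteq> j"
    thus "cs ! i \<noteq> cs ! j"
      using inj[of i j] inj[of j i] by (cases i j rule: linorder_cases) (auto simp: nth)
  qed
  moreover have "{cs ! i, cs ! (Suc i mod length cs)} \<in> edges T" if "i < length cs" for i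
  proof (cases "i = n")
    case True
    thus ?thesis using assms p by (simp add: len nth insert_commute)
  next
    case False
    thus ?thesis using that p(3)[of i] by (simp add: len nth adj_def)
  qed
  ultimately have "is_cycle (edges T) cs" using n2 by (simp add: is_cycle_def len)
  with assms(1) show False by (auto simp: rooted_tree_def)
qed

lemma far_end_in:
  assumes "rooted_tree T" "e \<in> edges T"
  shows "far_end T e \<in> e"
proof -
  have "card e = 2" using assms by (auto simp: rooted_tree_def)
  hence "finite e" "e \<noteq> {}" by (auto intro: card_ge_0_finite)
  then obtain k where "k \<in> e" by auto
  moreover have "\<And>y. y \<in> e \<Longrightarrow> depth T y \<le> Max (depth T ` e)"
    using \<open>finite e\<close> by simp
  ultimately show ?thesis
    unfolding far_end_def using arg_max_natI[of "\<lambda>w. w \<in> e" k "depth T" "Suc (Max (depth T ` e))"]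
    by (simp add: less_Suc_eq_le)
qed

lemma card_component_minus_less:
  assumes "rooted_tree T" "e \<in> edges T"
  shows "card (verts (component_minus T e x)) < card (verts T)"
proof -
  have fin: "finite (verts T)" and e: "card e = 2" "e \<subseteq> verts T"
    using assms by (auto simp: rooted_tree_def)
  obtain u w where uw: "e = {u, w}" using e(1) by (auto simp: card_2_iff)
  let ?R = "adj (edges T - {e})"
  have False if "(x, u) \<in> ?R\<^sup>*" "(x, w) \<in> ?R\<^sup>*"
  proof -
    have "(u, x) \<in> ?R\<^sup>*" using that(1) sym_rtrancl[OF sym_adj] by (meson symE)
    hence "(u, w) \<in> ?R\<^sup>*" using that(2) by simp
    thus False using tree_edge_is_bridge[of T u w] assms uw by simp
  qed
  hence "verts (component_minus T e x) \<subset> verts T"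
    using e(2) unfolding component_minus_simps uw by auto
  thus ?thesis using fin by (rule psubset_card_mono[rotated])
qed

lemma rooted_tree_component_minus:
  assumes "rooted_tree T" "x \<in> verts T"
  shows "rooted_tree (component_minus T e x)"
proof -
  let ?C = "component_minus T e x" and ?R = "adj (edges T - {e})"
  have reach: "(x, w) \<in> (adj (edges ?C))\<^sup>*" if "(x, w) \<in> ?R\<^sup>*" for w
    using that
  proof (induction rule: rtrancl_induct)
    case (step y z)
    from step(2) have yz: "{y, z} \<in> edges T" "{y, z} \<noteq> e" by (auto simp: adj_def)
    hence "{y, z} \<subseteq> verts T" using assms by (auto simp: rooted_tree_def)
    moreover have "(x, z) \<in> ?R\<^sup>*" using step(1,2) by simp
    ultimately have "(y, z) \<in> adj (edges ?C)"
      using yz step(1) by (simp add: adj_def component_minus_simps)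
    with step(3) show ?case by simp
  qed simp
  have "(u, w) \<in> (adj (edges ?C))\<^sup>*" if "u \<in> verts ?C" "w \<in> verts ?C" for u w
  proof -
    have "(x, u) \<in> (adj (edges ?C))\<^sup>*" "(x, w) \<in> (adj (edges ?C))\<^sup>*"
      using that reach by (auto simp: component_minus_simps)
    moreover have "sym ((adj (edges ?C))\<^sup>*)" by (intro sym_rtrancl sym_adj)
    ultimately show ?thesis by (meson symE rtrancl_trans)
  qed
  moreover have "edges ?C \<subseteq> edges T" by (auto simp: component_minus_simps)
  hence "is_cycle (edges T) cs" if "is_cycle (edges ?C) cs" for cs
    using that by (auto simp: is_cycle_def)
  moreover have "finite (verts ?C)" "x \<in> verts ?C"
    using assms by (auto simp: component_minus_simps rooted_tree_def)
  moreover have "f \<subseteq> verts ?C \<and> card f = 2" if "f \<in> edges ?C" for f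
    using that assms by (simp add: component_minus_simps rooted_tree_def)
  ultimately show ?thesis
    using assms unfolding rooted_tree_def by (auto simp: component_minus_simps(3))
qed

lemma rooted_tree_lower: "rooted_tree T \<Longrightarrow> rooted_tree (lower T e)"
  unfolding lower_def by (rule rooted_tree_component_minus) (auto simp: rooted_tree_def)

lemma rooted_tree_upper: "rooted_tree T \<Longrightarrow> e \<in> edges T \<Longrightarrow> rooted_tree (upper T e)"
  unfolding upper_def using far_end_in[of T e]
  by (intro rooted_tree_component_minus) (auto simp: rooted_tree_def)

lemma card_pieces_le:
  "finite (verts T) \<Longrightarrow> P \<in> set (pieces T es) \<Longrightarrow> card (verts P) \<le> card (verts T)"
proof (induction T es rule: pieces.induct)
  case (2 T e es)
  have sub: "verts (lower T e) \<subseteq> verts T" "verts (upper T e) \<subseteq> verts T"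
    by (auto simp: lower_def upper_def component_minus_simps)
  hence fin: "finite (verts (lower T e))" using 2(2) finite_subset by blast
  have "card (verts P) \<le> card (verts (lower T e)) \<or> P = upper T e"
    using 2 fin by auto
  thus ?case using sub 2(2) by (metis card_mono le_trans)
qed simp

lemma card_pieces_less:
  assumes "rooted_tree T" "es \<in> cut_seqs T r" "r \<noteq> 0" "P \<in> set (pieces T es)"
  shows "card (verts P) < card (verts T)"
proof -
  obtain e es' where es: "es = e # es'" "e \<in> edges T"
    using assms(2,3) by (cases es) (auto simp: cut_seqs_def)
  have "finite (verts (lower T e))"
    using rooted_tree_lower[OF assms(1)] by (auto simp: rooted_tree_def)
  hence "P = upper T e \<or> card (verts P) \<le> card (verts (lower T e))"
    using assms(4) es card_pieces_le by auto
  thus ?thesis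
    using card_component_minus_less[OF assms(1) es(2)]
    by (auto simp: lower_def upper_def intro: le_less_trans)
qed

section \<open>The numbers $\phi_T$\<close>

text \<open>The value on a \<open>rooted_graph\<close> that is not a rooted tree is junk; by \<open>phi_singleton\<close> and
  \<open>phi_rec\<close> the defining equations hold on rooted trees, and by \<open>rooted_tree_pieces\<close> the recursion
  never leaves these.\<close>

function phi :: "'a rooted_graph \<Rightarrow> rat" where
  "phi T = (if rooted_tree T \<and> card (verts T) \<ge> 2
     then - (\<Sum>k = 2..card (verts T). 1 / fact k *
              (\<Sum>es\<in>cut_seqs T (k - 1). prod_list (map phi (pieces T es))))
     else 1)"
  by pat_completeness auto
termination
  by (relation "measure (\<lambda>T. card (verts T))") (auto intro: card_pieces_less)

declare phi.simps [simp del]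

lemma phi_singleton: "card (verts T) = 1 \<Longrightarrow> phi T = 1"
  by (simp add: phi.simps)

lemma phi_rec:
  "rooted_tree T \<Longrightarrow> card (verts T) \<ge> 2 \<Longrightarrow>
   phi T = - (\<Sum>k = 2..card (verts T). 1 / fact k *
              (\<Sum>es\<in>cut_seqs T (k - 1). prod_list (map phi (pieces T es))))"
  by (subst phi.simps) simp

lemma reach_minus_two:
  assumes "(r, x) \<in> (adj (E - {e}))\<^sup>*"
  shows "(r, x) \<in> (adj (E - {e} - {f}))\<^sup>* \<or>
    (\<exists>a b. f = {a, b} \<and> (r, a) \<in> (adj (E - {e} - {f}))\<^sup>* \<and> (b, x) \<in> (adj (E - {e} - {f}))\<^sup>*)"
    (is "(_, _) \<in> ?R\<^sup>* \<or> _")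
  using assms
proof (induction rule: rtrancl_induct)
  case (step y z)
  show ?case
  proof (cases "f = {y, z}")
    case True
    with step(3) show ?thesis by (metis doubleton_eq_iff rtrancl.rtrancl_refl)
  next
    case False
    with step(2) have "(y, z) \<in> ?R" by (auto simp: adj_def)
    with step(3) show ?thesis
      by (elim disjE exE conjE) (blast intro: rtrancl.rtrancl_into_rtrancl)+
  qed
qed simp

lemma edge_succ_lower:
  assumes T: "rooted_tree T" and f: "f \<in> edges (lower T e)" and g: "g \<in> edges (lower T e)"
    and fg: "edge_succ T f g"
  shows "edge_succ (lower T e) f g"
proof -
  let ?r = "root T" and ?R = "adj (edges T - {e} - {f})"
  let ?L = "lower T e"
  have reach: "(?r, x) \<in> ?R\<^sup>*" if "x \<in> g" for x
  proof (rule ccontr)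
    assume "(?r, x) \<notin> ?R\<^sup>*"
    moreover have "(?r, x) \<in> (adj (edges T - {e}))\<^sup>*"
      using g that by (auto simp: lower_def component_minus_simps)
    ultimately obtain a b where ab: "f = {a, b}" "(?r, a) \<in> ?R\<^sup>*" "(b, x) \<in> ?R\<^sup>*"
      using reach_minus_two by metis
    let ?F = "adj (edges T - {f})"
    have "?R \<subseteq> ?F" by (auto simp: adj_def)
    hence sub: "?R\<^sup>* \<subseteq> ?F\<^sup>*" by (rule rtrancl_mono)
    have "(?r, x) \<in> ?F\<^sup>*"
      using fg that by (auto simp: edge_succ_def lower_def component_minus_simps)
    with ab sub have "(b, a) \<in> ?F\<^sup>*"
      using sym_rtrancl[OF sym_adj, of "edges T - {f}"]
      by (meson rtrancl_trans subsetD symE)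
    moreover have "{b, a} \<in> edges T" "f = {b, a}"
      using f ab by (auto simp: lower_def component_minus_simps insert_commute)
    ultimately show False using tree_edge_is_bridge[OF T, of b a] by simp
  qed
  have "(?r, x) \<in> (adj (edges ?L - {f}))\<^sup>*" if "(?r, x) \<in> ?R\<^sup>*" for x
    using that
  proof (induction rule: rtrancl_induct)
    case (step y z)
    have mono: "?R\<^sup>* \<subseteq> (adj (edges T - {e}))\<^sup>*"
      by (intro rtrancl_mono) (auto simp: adj_def)
    have "{y, z} \<in> edges T" "{y, z} \<noteq> e" "{y, z} \<noteq> f"
      using step(2) by (auto simp: adj_def)
    moreover have "{y, z} \<subseteq> verts T"
      using T calculation by (auto simp: rooted_tree_def)
    moreover have "(?r, y) \<in> (adj (edges T - {e}))\<^sup>*" "(?r, z) \<in> (adj (edges T - {e}))\<^sup>*"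
      using step(1,2) mono by (auto intro: rtrancl_into_rtrancl)
    ultimately have "(y, z) \<in> adj (edges ?L - {f})"
      by (simp add: adj_def lower_def component_minus_simps)
    with step(3) show ?case by simp
  qed simp
  with reach have "(?r, x) \<in> (adj (edges ?L - {f}))\<^sup>*" if "x \<in> g" for x
    using that by blast
  moreover have "g \<noteq> f" using fg by (auto simp: edge_succ_def lower_def component_minus_simps)
  moreover have "g \<subseteq> verts ?L" using g by (simp add: lower_def component_minus_simps)
  moreover have "root ?L = ?r" by (simp add: lower_def component_minus_simps)
  ultimately show ?thesis
    using g unfolding edge_succ_def lower_def[of ?L] component_minus_simps by auto
qed

lemma rooted_tree_pieces:
  assumes "rooted_tree T" "es \<in> cut_seqs T r" "P \<in> set (pieces T es)"
  shows "rooted_tree P"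
  using assms
proof (induction T es arbitrary: r rule: pieces.induct)
  case (2 T e es)
  have e: "e \<in> edges T" and es: "set es \<subseteq> edges (lower T e)" and "sorted_wrt (edge_succ T) es"
    using 2(3) by (auto simp: cut_seqs_def edge_succ_def)
  from this(3) have "sorted_wrt (edge_succ (lower T e)) es"
    by (rule sorted_wrt_mono_rel[rotated]) (use es edge_succ_lower[OF 2(2)] in blast)
  hence "es \<in> cut_seqs (lower T e) (length es)"
    using es by (simp add: cut_seqs_def)
  thus ?case
    using 2 e rooted_tree_lower[OF 2(2)] rooted_tree_upper[OF 2(2) e] by auto
qed simp

section \<open>Existence of chains and shrubs\<close>

text \<open>The tree on \<open>{..<n}\<close> with root \<open>0\<close> in which each \<open>i > 0\<close> is joined to \<open>p i < i\<close>.\<close>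

definition parent_tree :: "(nat \<Rightarrow> nat) \<Rightarrow> nat \<Rightarrow> nat rooted_graph" where
  "parent_tree p n = Rooted_Graph {..<n} ((\<lambda>i. {p i, i}) ` {0<..<n}) 0"

lemma rooted_tree_parent_tree:
  assumes p: "\<And>i. i > 0 \<Longrightarrow> p i < i" and n: "n > 0"
  shows "rooted_tree (parent_tree p n)"
proof -
  let ?E = "(\<lambda>i. {p i, i}) ` {0<..<n}"
  have reach: "(0, i) \<in> (adj ?E)\<^sup>*" if "i < n" for i
    using that
  proof (induction i rule: less_induct)
    case (less i)
    show ?case
    proof (cases "i = 0")
      case False
      hence "(p i, i) \<in> adj ?E" using less(2) by (auto simp: adj_def)
      moreover have "(0, p i) \<in> (adj ?E)\<^sup>*" using less p[of i] False by simp
      ultimately show ?thesis by simp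
    qed simp
  qed
  have conn: "(i, j) \<in> (adj ?E)\<^sup>*" if "i < n" "j < n" for i j
    using reach[OF that(1)] reach[OF that(2)] sym_rtrancl[OF sym_adj, of ?E]
    by (meson rtrancl_trans symE)
  have smaller: "j = p i" if ij: "{i, j} \<in> ?E" "j \<le> i" for i j
  proof -
    obtain k where k: "{i, j} = {p k, k}" "k \<in> {0<..<n}"
      using ij(1) by (rule imageE)
    from k(1) have "i = p k \<and> j = k \<or> i = k \<and> j = p k" by (simp only: doubleton_eq_iff)
    moreover have "p k < k" using k(2) p by simp
    ultimately show ?thesis using ij(2) by auto
  qed
  have acyc: "\<not> is_cycle ?E cs" for cs
  proof
    assume cyc: "is_cycle ?E cs"
    let ?l = "length cs"
    have l: "?l \<ge> 3" and dist: "distinct cs"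
      and adj: "\<And>i. i < ?l \<Longrightarrow> {cs ! i, cs ! (Suc i mod ?l)} \<in> ?E"
      using cyc by (auto simp: is_cycle_def)
    have "Max (set cs) \<in> set cs" using l by (intro Max_in) auto
    then obtain m where m: "m < ?l" "cs ! m = Max (set cs)" by (auto simp: in_set_conv_nth)
    have max: "cs ! i \<le> cs ! m" if "i < ?l" for i using that m by simp
    define s t where "s = Suc m mod ?l" and "t = (if m = 0 then ?l - 1 else m - 1)"
    have st: "s < ?l" "t < ?l" "Suc t mod ?l = m" "s \<noteq> t"
      using l m by (auto simp: s_def t_def mod_Suc split: if_splits)
    have "cs ! s = p (cs ! m)"
      using adj[OF m(1)] max[OF st(1)] by (intro smaller) (simp_all add: s_def)
    moreover have "cs ! t = p (cs ! m)"
      using adj[OF st(2)] max[OF st(2)] st(3) by (intro smaller) (simp_all add: insert_commute)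
    ultimately show False using dist st by (metis nth_eq_iff_index_eq)
  qed
  have "card {p i, i} = 2 \<and> p i < n" if "0 < i" "i < n" for i
    using p[OF that(1)] that by auto
  thus ?thesis
    unfolding rooted_tree_def parent_tree_def using n conn acyc by auto
qed

lemma is_chain_exists:
  assumes "n \<ge> 1"
  shows "is_chain n (parent_tree (\<lambda>i. i - 1) n)"
proof -
  let ?T = "parent_tree (\<lambda>i. i - 1) n"
  let ?R = "adj (edges ?T)"
  have le: "i \<le> k" if "(0, i) \<in> ?R ^^ k" for i k
    using that
  proof (induction k arbitrary: i)
    case (Suc k)
    then obtain j where "(0, j) \<in> ?R ^^ k" "(j, i) \<in> ?R" by auto
    moreover from this(2) have "i \<le> Suc j"
      by (auto simp: adj_def parent_tree_def doubleton_eq_iff)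
    ultimately show ?case using Suc.IH[of j] by simp
  qed simp
  have ge: "(0, i) \<in> ?R ^^ i" if "i < n" for i
    using that
  proof (induction i)
    case (Suc i)
    hence "(i, Suc i) \<in> ?R"
      by (auto simp: adj_def parent_tree_def intro!: image_eqI[of _ _ "Suc i"])
    with Suc show ?case by auto
  qed simp
  have root: "root ?T = 0" by (simp add: parent_tree_def)
  have "depth ?T i = i" if "i < n" for i
    unfolding depth_def root by (rule Least_equality) (rule ge[OF that], rule le)
  hence "depth ?T ` verts ?T = {..<n}" by (auto simp: parent_tree_def)
  hence "height ?T = Max {..<n}" by (simp add: height_def)
  also have "\<dots> = n - 1" using assms by (intro Max_eqI) auto
  finally show ?thesis
    using assms rooted_tree_parent_tree[of "\<lambda>i. i - 1" n]
    by (simp add: is_chain_def parent_tree_def)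
qed

lemma is_shrub_exists: "is_shrub n (parent_tree (\<lambda>i. 0) (n + 1))"
proof -
  have "rooted_tree (parent_tree (\<lambda>i. 0) (n + 1))"
    by (rule rooted_tree_parent_tree) simp_all
  thus ?thesis by (simp add: is_shrub_def parent_tree_def)
qed

section \<open>Bernoulli numbers\<close>

definition bernoulli_num :: "nat \<Rightarrow> rat" where
  "bernoulli_num n = fact n * fps_nth (fps_X / (fps_exp 1 - 1)) n"

lemma bernoulli_num_egf:
  "fps_X / (fps_exp 1 - 1) = Abs_fps (\<lambda>n. bernoulli_num n / fact n)"
  by (rule fps_ext) (simp add: bernoulli_num_def)

end

theory Submission
  imports Defs
begin

text \<open>
  Let \<open>cut_sum T r\<close> be the sum of \<open>\<Prod> phi\<close> of the pieces over all cut sequences of length \<open>r\<close>, so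
  that the recursion for \<open>phi\<close> reads \<open>phi T = - (\<Sum>k\<ge>2. cut_sum T (k - 1) / k!)\<close>. After the first
  cut \<open>e\<close>, the rest of a cut sequence of \<open>T\<close> is an arbitrary cut sequence of \<open>lower T e\<close>, whence
  \<open>cut_sum T (r + 1) = (\<Sum>e. phi (upper T e) * cut_sum (lower T e) r)\<close> (\<open>cut_sum_Suc\<close>). For both
  families this recursion is a product of power series.

  Cutting a path on \<open>n\<close> vertices gives two paths on \<open>j\<close> and \<open>n - j\<close> vertices, and \<open>j\<close>
  takes each value in \<open>{1..<n}\<close> once. So cutting \<open>r\<close> times runs through the compositions of \<open>n\<close>
  into \<open>r + 1\<close> parts, and \<open>cut_sum\<close> is the \<open>n\<close>-th coefficient of \<open>c ^ (r + 1)\<close>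
  (\<open>cut_sum_path_graph\<close>). The recursion then says that \<open>e\<^sup>c - 1\<close> has no coefficient in degree
  \<open>n \<ge> 2\<close>, that is, \<open>e\<^sup>c = 1 + x\<close>.

  Cutting a star with \<open>n\<close> leaves splits off one leaf, with \<open>phi = 1\<close>, and leaves a star
  with \<open>n - 1\<close> leaves; each of the \<open>n\<close> leaves is a possible choice. So \<open>cut_sum\<close> for \<open>r\<close> cuts is
  \<open>n!\<close> times the \<open>n\<close>-th coefficient of \<open>x\<^sup>r s\<close> (\<open>cut_sum_star_graph\<close>), and the recursion says that
  \<open>(e\<^sup>x - 1) s\<close> has no coefficient in degree \<open>n + 1 \<ge> 2\<close>, that is, \<open>(e\<^sup>x - 1) s = x\<close>.

  In each case the known power series is substituted for \<open>c\<close> or \<open>s\<close> and the equality of the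
  coefficients is proved by strong induction on the size of the tree: the terms with \<open>k \<ge> 2\<close>
  involve smaller trees only. Before that, the abstract chains and shrubs are identified with the
  concrete graphs \<open>path_graph\<close> and \<open>star_graph\<close>, whose \<open>lower\<close> and \<open>upper\<close> parts are again such
  graphs.
\<close>

section \<open>Summing over cut sequences\<close>

definition cut_sum :: "'a rooted_graph \<Rightarrow> nat \<Rightarrow> rat" where
  "cut_sum T r = (\<Sum>es\<in>cut_seqs T r. prod_list (map phi (pieces T es)))"

lemma phi_cut_sum:
  assumes "rooted_tree T" "card (verts T) \<ge> 2"
  shows "phi T = - (\<Sum>k = 2..card (verts T). cut_sum T (k - 1) / fact k)"
  using phi_rec[OF assms] by (simp add: cut_sum_def)

lemma finite_edges: "rooted_tree T \<Longrightarrow> finite (edges T)"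
  by (rule finite_subset[of _ "Pow (verts T)"]) (auto simp: rooted_tree_def)

lemma edges_lower_subset: "edges (lower T e) \<subseteq> edges T - {e}"
  by (auto simp: lower_def component_minus_simps)

text \<open>The converse of \<open>edge_succ_lower\<close>: paths in the smaller tree are paths in the larger one.\<close>

lemma edge_succ_if_edge_succ_lower:
  assumes "edge_succ (lower T e) f g"
  shows "edge_succ T f g"
proof -
  have "adj (edges (lower T e) - {f}) \<subseteq> adj (edges T - {f})"
    using edges_lower_subset[of T e] by (auto simp: adj_def)
  hence "(adj (edges (lower T e) - {f}))\<^sup>* \<subseteq> (adj (edges T - {f}))\<^sup>*"
    by (rule rtrancl_mono)
  moreover have "verts (lower T e) \<subseteq> verts T" "root (lower T e) = root T"
    by (auto simp: lower_def component_minus_simps)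
  ultimately show ?thesis
    using assms edges_lower_subset[of T e]
    unfolding edge_succ_def lower_def[of "lower T e"] lower_def[of T f] component_minus_simps
    by (auto 4 4)
qed

text \<open>Between edges of \<open>lower T e\<close> the orders \<open>edge_succ T\<close> and \<open>edge_succ (lower T e)\<close> coincide, and
  the requirement that \<open>e\<close> precede all later edges says that these lie in \<open>lower T e\<close>.\<close>

lemma Cons_mem_cut_seqs_iff:
  assumes "rooted_tree T"
  shows "e # es \<in> cut_seqs T (Suc r) \<longleftrightarrow> e \<in> edges T \<and> es \<in> cut_seqs (lower T e) r"
proof -
  have "edge_succ T f g \<longleftrightarrow> edge_succ (lower T e) f g"
    if "f \<in> edges (lower T e)" "g \<in> edges (lower T e)" for f g
    using edge_succ_lower[OF assms that] edge_succ_if_edge_succ_lower[of T e f g] by blast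
  hence "sorted_wrt (edge_succ T) es \<longleftrightarrow> sorted_wrt (edge_succ (lower T e)) es"
    if "set es \<subseteq> edges (lower T e)"
    using that by (auto intro: sorted_wrt_mono_rel[rotated])
  thus ?thesis
    using edges_lower_subset[of T e] by (auto simp: cut_seqs_def edge_succ_def)
qed

lemma finite_cut_seqs: "rooted_tree T \<Longrightarrow> finite (cut_seqs T r)"
  by (rule finite_subset[OF _ finite_lists_length_eq[OF finite_edges, of T r]])
    (auto simp: cut_seqs_def)

lemma cut_sum_0: "cut_sum T 0 = phi T"
proof -
  have "cut_seqs T 0 = {[]}" by (auto simp: cut_seqs_def)
  thus ?thesis by (simp add: cut_sum_def)
qed

lemma cut_sum_Suc:
  assumes "rooted_tree T"
  shows "cut_sum T (Suc r) = (\<Sum>e\<in>edges T. phi (upper T e) * cut_sum (lower T e) r)"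
proof -
  let ?A = "SIGMA e:edges T. cut_seqs (lower T e) r"
  let ?w = "\<lambda>T es. prod_list (map phi (pieces T es))"
  have "cut_seqs T (Suc r) = (\<lambda>(e, es). e # es) ` ?A"
  proof (intro set_eqI)
    fix es show "es \<in> cut_seqs T (Suc r) \<longleftrightarrow> es \<in> (\<lambda>(e, es). e # es) ` ?A"
    proof (cases es)
      case (Cons e es')
      thus ?thesis using Cons_mem_cut_seqs_iff[OF assms] by auto
    qed (auto simp: cut_seqs_def)
  qed
  moreover have "inj_on (\<lambda>(e, es). e # es) ?A" by (auto simp: inj_on_def)
  ultimately have "cut_sum T (Suc r) = (\<Sum>(e, es)\<in>?A. ?w T (e # es))"
    by (simp add: cut_sum_def sum.reindex split_def)
  also have "\<dots> = (\<Sum>e\<in>edges T. \<Sum>es\<in>cut_seqs (lower T e) r. ?w T (e # es))"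
    using assms by (subst sum.Sigma) (auto simp: finite_edges finite_cut_seqs rooted_tree_lower)
  finally show ?thesis by (simp add: cut_sum_def sum_distrib_left)
qed

section \<open>Depth\<close>

lemma depth_le: "(root T, w) \<in> adj (edges T) ^^ n \<Longrightarrow> depth T w \<le> n"
  unfolding depth_def by (rule Least_le)

lemma relpow_depth:
  assumes "rooted_tree T" "w \<in> verts T"
  shows "(root T, w) \<in> adj (edges T) ^^ depth T w"
proof -
  have "(root T, w) \<in> (adj (edges T))\<^sup>*" using assms by (auto simp: rooted_tree_def)
  thus ?thesis unfolding depth_def by (auto simp: rtrancl_power intro: LeastI)
qed

lemma depth_edge_le:
  assumes "rooted_tree T" "{u, w} \<in> edges T"
  shows "depth T w \<le> Suc (depth T u)"
proof (rule depth_le)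
  have "u \<in> verts T" using assms by (auto simp: rooted_tree_def)
  thus "(root T, w) \<in> adj (edges T) ^^ Suc (depth T u)"
    using relpow_depth[OF assms(1)] assms(2) by (auto simp: adj_def)
qed

text \<open>The two ends of an edge of a tree have different depths, so \<open>far_end\<close> is identified by
  comparing them.\<close>

lemma far_end_eq:
  assumes "rooted_tree T" "{u, w} \<in> edges T" "depth T u < depth T w"
  shows "far_end T {u, w} = w"
proof -
  have "\<forall>y. y \<in> {u, w} \<longrightarrow> depth T y < Suc (depth T w)" using assms(3) by auto
  hence "depth T w \<le> depth T (far_end T {u, w})"
    unfolding far_end_def using arg_max_nat_le[of "\<lambda>x. x \<in> {u, w}" w "depth T"] by blast
  thus ?thesis using far_end_in[OF assms(1,2)] assms(3) by auto
qed

section \<open>Chains\<close>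

text \<open>The part with indices in \<open>{a..<b}\<close> of a path with vertices \<open>p 0, p 1, \<dots>\<close>. With \<open>p\<close> fixed and
  both bounds free, the two parts left by a cut are again of this form.\<close>

definition path_graph :: "(nat \<Rightarrow> 'a) \<Rightarrow> nat \<Rightarrow> nat \<Rightarrow> 'a rooted_graph" where
  "path_graph p a b =
     Rooted_Graph (p ` {a..<b}) ((\<lambda>i. {p i, p (Suc i)}) ` {a..<b - 1}) (p a)"

text \<open>A shortest path from the root to a vertex of maximal depth \<open>n - 1\<close> has \<open>n\<close> vertices of
  depths \<open>0, \<dots>, n - 1\<close>, hence it visits every vertex. Since the depths of adjacent vertices differ by
  at most \<open>1\<close>, every edge joins consecutive vertices of that path.\<close>

lemma chain_is_path_graph:
  assumes "is_chain n T" "n \<ge> 1"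
  obtains p where "inj_on p {0..<n}" "T = path_graph p 0 n"
proof -
  have T: "rooted_tree T" and card: "card (verts T) = n" and h: "height T = n - 1"
    using assms by (auto simp: is_chain_def)
  have fin: "finite (verts T)" and ne: "verts T \<noteq> {}"
    using T by (auto simp: rooted_tree_def)
  have "height T \<in> depth T ` verts T"
    unfolding height_def using fin ne by (intro Max_in) auto
  then obtain w where w: "w \<in> verts T" "depth T w = n - 1"
    unfolding h by (metis imageE)
  obtain p where p: "p 0 = root T" "p (n - 1) = w"
      and pe: "\<And>i. i < n - 1 \<Longrightarrow> {p i, p (Suc i)} \<in> edges T"
    using relpow_depth[OF T w(1)] w(2) by (auto simp: relpow_fun_conv adj_def)
  \<comment> \<open>Depth grows by at most one per step; reaching \<open>n - 1\<close> after \<open>n - 1\<close> steps forces exactly one.\<close>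
  have up: "depth T (p i) \<le> i" if "i < n" for i
    using that
  proof (induction i)
    case 0
    show ?case by (rule depth_le) (simp add: p)
  next
    case (Suc i)
    hence "i < n - 1" by simp
    from depth_edge_le[OF T pe[OF this]] Suc show ?case by simp
  qed
  have down: "depth T w \<le> depth T (p i) + (n - 1 - i)" if "i < n" for i
    using that
  proof (induction "n - 1 - i" arbitrary: i)
    case 0
    hence "i = n - 1" by simp
    hence "p i = w" using p(2) by simp
    thus ?case by simp
  next
    case (Suc k)
    hence "depth T w \<le> depth T (p (Suc i)) + (n - 1 - Suc i)" by (intro Suc(1)) auto
    moreover have "depth T (p (Suc i)) \<le> Suc (depth T (p i))"
      using Suc by (intro depth_edge_le[OF T pe]) auto
    ultimately show ?case using Suc(2) by simp
  qed
  have depth: "depth T (p i) = i" if "i < n" for i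
    using up[OF that] down[OF that] w(2) that by simp
  hence inj: "inj_on p {0..<n}" by (intro inj_on_inverseI[of _ "depth T"]) auto
  have "p i \<in> verts T" if "i < n" for i
  proof (cases "i = n - 1")
    case True
    thus ?thesis using p w by simp
  next
    case False
    hence "{p i, p (Suc i)} \<in> edges T" using that by (intro pe) simp
    thus ?thesis using T by (auto simp: rooted_tree_def)
  qed
  hence "p ` {0..<n} \<subseteq> verts T" by auto
  hence verts: "verts T = p ` {0..<n}"
    using card_subset_eq[OF fin] card inj by (metis card_atLeastLessThan card_image diff_zero)
  have "e \<in> (\<lambda>i. {p i, p (Suc i)}) ` {0..<n - 1}" if e: "e \<in> edges T" for e
  proof -
    have "e \<subseteq> verts T" "card e = 2" using e T by (auto simp: rooted_tree_def)
    then obtain i j where ij: "e = {p i, p j}" "i < n" "j < n" "p i \<noteq> p j"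
      unfolding verts by (auto simp: card_2_iff)
    have "i \<noteq> j" using ij(4) by auto
    moreover have "j \<le> Suc i" "i \<le> Suc j"
      using depth_edge_le[OF T, of "p i" "p j"] depth_edge_le[OF T, of "p j" "p i"]
        ij e depth by (auto simp: insert_commute)
    ultimately have "j = Suc i \<or> i = Suc j" by linarith
    thus ?thesis using ij(1-3) by (auto simp: insert_commute)
  qed
  hence "edges T = (\<lambda>i. {p i, p (Suc i)}) ` {0..<n - 1}" using pe by auto
  hence "T = path_graph p 0 n"
    by (cases T) (use verts p in \<open>simp add: path_graph_def\<close>)
  with inj show ?thesis by (rule that)
qed

lemma path_edge_eq_iff:
  assumes "inj_on p {a..<b}" "i \<in> {a..<b - 1}" "j \<in> {a..<b - 1}"
  shows "{p i, p (Suc i)} = {p j, p (Suc j)} \<longleftrightarrow> i = j"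
proof -
  have "p x = p y \<longleftrightarrow> x = y" if "x \<in> {a..<b}" "y \<in> {a..<b}" for x y
    using assms(1) that by (auto dest: inj_onD)
  thus ?thesis using assms(2,3) by (auto simp: doubleton_eq_iff)
qed

lemma adj_path_graph_minus:
  assumes "inj_on p {a..<b}" "i \<in> {a..<b - 1}" "x \<in> {a..<b}" "y \<in> {a..<b}"
  shows "(p x, p y) \<in> adj (edges (path_graph p a b) - {{p i, p (Suc i)}}) \<longleftrightarrow>
    (y = Suc x \<and> x \<noteq> i) \<or> (x = Suc y \<and> y \<noteq> i)"
proof -
  have eq: "p x = p y \<longleftrightarrow> x = y" if "x \<in> {a..<b}" "y \<in> {a..<b}" for x y
    using assms(1) that by (auto dest: inj_onD)
  have "(\<exists>j\<in>{a..<b - 1}. {p x, p y} = {p j, p (Suc j)}) \<longleftrightarrow> y = Suc x \<or> x = Suc y"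
    using assms(3,4) by (auto simp: doubleton_eq_iff eq)
  moreover have "{p x, p y} = {p i, p (Suc i)} \<longleftrightarrow> x = i \<and> y = Suc i \<or> x = Suc i \<and> y = i"
    using assms(2-4) by (auto simp: doubleton_eq_iff eq)
  moreover have "(p x, p y) \<in> adj (edges (path_graph p a b) - {{p i, p (Suc i)}}) \<longleftrightarrow>
      (\<exists>j\<in>{a..<b - 1}. {p x, p y} = {p j, p (Suc j)}) \<and> {p x, p y} \<noteq> {p i, p (Suc i)}"
    by (simp only: adj_def path_graph_def rooted_graph.sel mem_Collect_eq case_prod_conv
        Diff_iff image_iff singleton_iff)
  ultimately show ?thesis by (simp only:) linarith
qed

text \<open>Both components of a cut path at once: \<open>{c..<d}\<close> is either the initial or the final index
  interval, and in both cases the edges other than the one cut do not lead out of it.\<close>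

lemma component_path_graph:
  assumes inj: "inj_on p {a..<b}" and i: "i \<in> {a..<b - 1}"
    and cd: "(c, d) = (a, Suc i) \<or> (c, d) = (Suc i, b)"
  shows "component_minus (path_graph p a b) {p i, p (Suc i)} (p c) = path_graph p c d"
proof -
  let ?P = "path_graph p a b" and ?e = "{p i, p (Suc i)}"
  let ?R = "adj (edges ?P - {?e})"
  have sub: "{c..<d} \<subseteq> {a..<b}" and c: "c < d" using cd i by auto
  have adj: "(p x, p y) \<in> ?R \<longleftrightarrow> (y = Suc x \<and> x \<noteq> i) \<or> (x = Suc y \<and> y \<noteq> i)"
    if "x \<in> {a..<b}" "y \<in> {a..<b}" for x y
    using adj_path_graph_minus[OF inj i that] .
  have R: "\<exists>y\<in>{a..<b}. w = p y" if "(u, w) \<in> ?R" for u w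
  proof -
    from that have "{u, w} \<in> (\<lambda>j. {p j, p (Suc j)}) ` {a..<b - 1}"
      by (simp add: adj_def path_graph_def)
    then obtain j where j: "{u, w} = {p j, p (Suc j)}" "j \<in> {a..<b - 1}"
      by (rule imageE)
    from j(1) have "w = p j \<or> w = p (Suc j)" by auto
    moreover have "j \<in> {a..<b}" "Suc j \<in> {a..<b}" using j(2) by auto
    ultimately show ?thesis by blast
  qed
  have "w \<in> p ` {c..<d}" if "(p c, w) \<in> ?R\<^sup>*" for w
    using that
  proof (induction rule: rtrancl_induct)
    case (step v w)
    then obtain x y where "v = p x" "x \<in> {c..<d}" "w = p y" "y \<in> {a..<b}"
      using R by blast
    moreover from this step(2) sub
    have "(y = Suc x \<and> x \<noteq> i) \<or> (x = Suc y \<and> y \<noteq> i)" using adj by blast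
    ultimately have "y \<in> {c..<d}" using cd by auto
    thus ?case using \<open>w = p y\<close> by blast
  qed (use c in auto)
  moreover have "(p c, p (c + k)) \<in> ?R\<^sup>*" if "c + k < d" for k
    using that
  proof (induction k)
    case (Suc k)
    have "(p (c + k), p (c + Suc k)) \<in> ?R"
      using Suc(2) sub cd i by (subst adj) auto
    thus ?case using Suc by auto
  qed simp
  hence "(p c, p x) \<in> ?R\<^sup>*" if "x \<in> {c..<d}" for x
    using that by (metis atLeastLessThan_iff le_add_diff_inverse)
  ultimately have verts: "{w \<in> verts ?P. (p c, w) \<in> ?R\<^sup>*} = p ` {c..<d}"
    using sub by (auto simp: path_graph_def)
  have mem: "p x \<in> p ` {c..<d} \<longleftrightarrow> x \<in> {c..<d}" if "x \<in> {a..<b}" for x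
    using inj that sub by (auto dest!: inj_onD)
  have "{j \<in> {a..<b - 1}. j \<noteq> i \<and> j \<in> {c..<d} \<and> Suc j \<in> {c..<d}} = {c..<d - 1}"
    using cd i by auto
  moreover have "{f \<in> edges ?P - {?e}. f \<subseteq> p ` {c..<d}} =
      (\<lambda>j. {p j, p (Suc j)}) ` {j \<in> {a..<b - 1}. j \<noteq> i \<and> j \<in> {c..<d} \<and> Suc j \<in> {c..<d}}"
  proof -
    have "{p j, p (Suc j)} \<noteq> ?e \<and> {p j, p (Suc j)} \<subseteq> p ` {c..<d} \<longleftrightarrow>
        j \<noteq> i \<and> j \<in> {c..<d} \<and> Suc j \<in> {c..<d}" if j: "j \<in> {a..<b - 1}" for j
    proof -
      have "j \<in> {a..<b}" "Suc j \<in> {a..<b}" using j by auto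
      thus ?thesis by (simp only: path_edge_eq_iff[OF inj j i] mem insert_subset) simp
    qed
    moreover have "edges ?P = (\<lambda>j. {p j, p (Suc j)}) ` {a..<b - 1}"
      by (simp add: path_graph_def)
    ultimately show ?thesis by (simp only:) blast
  qed
  ultimately show ?thesis
    unfolding component_minus_def verts Let_def by (simp add: path_graph_def)
qed

text \<open>A walk of length \<open>k\<close> from the first vertex advances at most \<open>k\<close> positions; this is the lower
  bound for the depths in a path.\<close>

lemma relpow_path_graph:
  assumes "(p a, w) \<in> adj (edges (path_graph p a b)) ^^ k" "inj_on p {a..<b}" "a < b"
  shows "w \<in> p ` ({a..<b} \<inter> {a..a + k})"
  using assms(1)
proof (induction k arbitrary: w)
  case 0
  thus ?case using assms(3) by auto
next
  case (Suc k)
  then obtain v where "(p a, v) \<in> adj (edges (path_graph p a b)) ^^ k"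
    and vw: "(v, w) \<in> adj (edges (path_graph p a b))" by auto
  with Suc.IH have "v \<in> p ` ({a..<b} \<inter> {a..a + k})" by blast
  then obtain x where x: "v = p x" "x \<in> {a..<b}" "x \<le> a + k" by auto
  from vw have "{v, w} \<in> (\<lambda>j. {p j, p (Suc j)}) ` {a..<b - 1}"
    by (simp add: adj_def path_graph_def)
  then obtain j where eq: "{v, w} = {p j, p (Suc j)}" and j: "j \<in> {a..<b - 1}"
    by (rule imageE)
  from eq consider "v = p j" "w = p (Suc j)" | "v = p (Suc j)" "w = p j"
    by (auto simp: doubleton_eq_iff)
  thus ?case
  proof cases
    case 1
    hence "x = j" using inj_onD[OF assms(2), of x j] x j by auto
    thus ?thesis using 1(2) x j by auto
  next
    case 2
    hence "x = Suc j" using inj_onD[OF assms(2), of x "Suc j"] x j by auto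
    thus ?thesis using 2(2) x j by auto
  qed
qed

lemma depth_path_graph:
  assumes T: "rooted_tree (path_graph p a b)" and inj: "inj_on p {a..<b}" and j: "j \<in> {a..<b}"
  shows "depth (path_graph p a b) (p j) = j - a"
proof -
  let ?P = "path_graph p a b"
  have up: "depth ?P (p (a + k)) \<le> k" if "a + k < b" for k
    using that
  proof (induction k)
    case 0
    show ?case by (rule depth_le) (simp add: path_graph_def)
  next
    case (Suc k)
    hence "{p (a + k), p (a + Suc k)} \<in> edges ?P" by (auto simp: path_graph_def)
    from depth_edge_le[OF T this] Suc show ?case by simp
  qed
  have "(p a, p j) \<in> adj (edges ?P) ^^ depth ?P (p j)"
    using relpow_depth[OF T, of "p j"] j by (simp add: path_graph_def)
  hence "p j \<in> p ` ({a..<b} \<inter> {a..a + depth ?P (p j)})"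
    using relpow_path_graph inj j by fastforce
  hence "j \<le> a + depth ?P (p j)" using inj j by (auto dest!: inj_onD)
  moreover have "depth ?P (p j) \<le> j - a" using up[of "j - a"] j by simp
  ultimately show ?thesis by simp
qed

lemma lower_path_graph:
  assumes "inj_on p {a..<b}" "i \<in> {a..<b - 1}"
  shows "lower (path_graph p a b) {p i, p (Suc i)} = path_graph p a (Suc i)"
proof -
  have "root (path_graph p a b) = p a" by (simp add: path_graph_def)
  thus ?thesis unfolding lower_def using component_path_graph[OF assms] by metis
qed

lemma upper_path_graph:
  assumes "rooted_tree (path_graph p a b)" "inj_on p {a..<b}" "i \<in> {a..<b - 1}"
  shows "upper (path_graph p a b) {p i, p (Suc i)} = path_graph p (Suc i) b"
proof -
  have "far_end (path_graph p a b) {p i, p (Suc i)} = p (Suc i)"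
  proof (rule far_end_eq[OF assms(1)])
    show "{p i, p (Suc i)} \<in> edges (path_graph p a b)"
      using assms(3) by (auto simp: path_graph_def)
    show "depth (path_graph p a b) (p i) < depth (path_graph p a b) (p (Suc i))"
      using depth_path_graph[OF assms(1,2), of i] depth_path_graph[OF assms(1,2), of "Suc i"]
        assms(3) by auto
  qed
  thus ?thesis unfolding upper_def using component_path_graph[OF assms(2,3)] by metis
qed

lemma cut_sum_path_graph_Suc:
  assumes "rooted_tree (path_graph p a b)" "inj_on p {a..<b}"
  shows "cut_sum (path_graph p a b) (Suc r) =
    (\<Sum>i\<in>{a..<b - 1}. phi (path_graph p (Suc i) b) * cut_sum (path_graph p a (Suc i)) r)"
proof -
  have "inj_on (\<lambda>i. {p i, p (Suc i)}) {a..<b - 1}"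
    using path_edge_eq_iff[OF assms(2)] by (auto intro!: inj_onI)
  moreover have "edges (path_graph p a b) = (\<lambda>i. {p i, p (Suc i)}) ` {a..<b - 1}"
    by (simp add: path_graph_def)
  ultimately show ?thesis
    using assms by (simp add: cut_sum_Suc sum.reindex lower_path_graph upper_path_graph)
qed

text \<open>One more cut is one more factor \<open>L\<close>: the sum over the position of the cut is the convolution
  that defines the product of power series, and its two end terms vanish because \<open>L\<close> has no
  constant term. The values of \<open>phi\<close> are assumed only for paths with fewer than \<open>b - a\<close> vertices, so
  that the lemma can serve inside an induction that determines these values.\<close>

lemma cut_sum_path_graph:
  assumes "rooted_tree (path_graph p a b)" "inj_on p {a..<b}" "a < b"
    and phi: "\<And>c d. rooted_tree (path_graph p c d) \<Longrightarrow> inj_on p {c..<d} \<Longrightarrow> c < d \<Longrightarrow>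
      d - c < b - a \<Longrightarrow> phi (path_graph p c d) = fps_nth L (d - c)"
    and L: "fps_nth L 0 = 0"
  shows "cut_sum (path_graph p a b) (Suc r) = fps_nth (L ^ Suc (Suc r)) (b - a)"
  using assms(1-4)
proof (induction r arbitrary: b)
  \<comment> \<open>Shared by base case and induction step, which differ only in how \<open>lower\<close> is obtained: from
    the values of \<open>phi\<close> if no further cut follows, else from the induction hypothesis.\<close>
  have step: "cut_sum (path_graph p a b) (Suc r) = fps_nth (L ^ Suc (Suc r)) (b - a)"
    if T: "rooted_tree (path_graph p a b)" and inj: "inj_on p {a..<b}" and ab: "a < b"
    and phi: "\<And>c d. rooted_tree (path_graph p c d) \<Longrightarrow> inj_on p {c..<d} \<Longrightarrow> c < d \<Longrightarrow>
      d - c < b - a \<Longrightarrow> phi (path_graph p c d) = fps_nth L (d - c)"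
    and lower: "\<And>i. i \<in> {a..<b - 1} \<Longrightarrow> rooted_tree (path_graph p a (Suc i)) \<Longrightarrow>
      inj_on p {a..<Suc i} \<Longrightarrow>
      cut_sum (path_graph p a (Suc i)) r = fps_nth (L ^ Suc r) (Suc i - a)" for r b
  proof -
    let ?n = "b - a" and ?M = "L ^ Suc r"
    have "phi (path_graph p (Suc i) b) = fps_nth L (b - Suc i) \<and>
        cut_sum (path_graph p a (Suc i)) r = fps_nth ?M (Suc i - a)" if i: "i \<in> {a..<b - 1}" for i
    proof -
      have e: "{p i, p (Suc i)} \<in> edges (path_graph p a b)"
        using i by (auto simp: path_graph_def)
      have "rooted_tree (path_graph p a (Suc i))" "rooted_tree (path_graph p (Suc i) b)"
        using rooted_tree_lower[OF T, of "{p i, p (Suc i)}"] rooted_tree_upper[OF T e]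
        by (simp_all add: lower_path_graph[OF inj i] upper_path_graph[OF T inj i])
      moreover have "inj_on p {a..<Suc i}" "inj_on p {Suc i..<b}"
        using i by (auto intro!: inj_on_subset[OF inj])
      ultimately show ?thesis using lower phi[of "Suc i" b] i by auto
    qed
    hence "cut_sum (path_graph p a b) (Suc r) =
        (\<Sum>i\<in>{a..<b - 1}. fps_nth ?M (Suc i - a) * fps_nth L (b - Suc i))"
      by (simp add: cut_sum_path_graph_Suc[OF T inj] mult.commute del: power_Suc)
    also have "\<dots> = (\<Sum>j\<in>{1..<?n}. fps_nth ?M j * fps_nth L (?n - j))"
      by (rule sum.reindex_bij_witness[of _ "\<lambda>j. a + j - 1" "\<lambda>i. Suc i - a"])
        (auto simp del: power_Suc)
    also have "\<dots> = (\<Sum>j=0..?n. fps_nth ?M j * fps_nth L (?n - j))"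
    proof (rule sum.mono_neutral_left)
      show "\<forall>j\<in>{0..?n} - {1..<?n}. fps_nth ?M j * fps_nth L (?n - j) = 0"
      proof
        fix j assume "j \<in> {0..?n} - {1..<?n}"
        hence "j = 0 \<or> j = ?n" by auto
        thus "fps_nth ?M j * fps_nth L (?n - j) = 0" using L by auto
      qed
    qed auto
    also have "\<dots> = fps_nth (L ^ Suc (Suc r)) ?n"
      by (simp only: power_Suc2[of L "Suc r"] fps_mult_nth)
    finally show ?thesis .
  qed
  {
    case 0
    show ?case
      by (rule step[OF 0(1-3)]) (use 0 in \<open>auto simp: cut_sum_0\<close>)
  next
    case (Suc r)
    show ?case
    proof (rule step[OF Suc.prems(1-3)])
      fix i assume i: "i \<in> {a..<b - 1}" "rooted_tree (path_graph p a (Suc i))" "inj_on p {a..<Suc i}"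
      show "cut_sum (path_graph p a (Suc i)) (Suc r) = fps_nth (L ^ Suc (Suc r)) (Suc i - a)"
        by (rule Suc.IH[OF i(2,3)]) (use i Suc.prems(4) in auto)
    qed (use Suc.prems(4) in auto)
  }
qed

text \<open>The recursion for chains as an identity of coefficients: this is degree \<open>n\<close> of
  \<open>exp (ln (1 + x)) - 1 = x\<close>.\<close>

lemma fps_ln_power_sum:
  assumes "n \<ge> 2"
  shows "fps_nth (fps_ln 1) n = - (\<Sum>k=2..n. fps_nth (fps_ln 1 ^ k) n / fact k :: rat)"
proof -
  let ?L = "fps_ln 1 :: rat fps"
  have "(fps_exp 1 - 1) oo ?L = fps_X"
    by (simp add: fps_ln_fps_exp_inv fps_inv_right)
  hence "0 = fps_nth ((fps_exp 1 - 1) oo ?L) n" using assms by simp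
  also have "\<dots> = (\<Sum>k=0..n. fps_nth (fps_exp 1 - 1) k * fps_nth (?L ^ k) n)"
    by (rule fps_compose_nth)
  also have "\<dots> = (\<Sum>k=1..n. fps_nth (?L ^ k) n / fact k)"
    by (rule sum.mono_neutral_cong_right) auto
  also have "\<dots> = fps_nth ?L n + (\<Sum>k=2..n. fps_nth (?L ^ k) n / fact k)"
    using assms by (subst sum.atLeast_Suc_atMost) (auto simp: numeral_2_eq_2)
  finally show ?thesis by simp
qed

text \<open>By strong induction on the number of vertices, the numbers \<open>phi\<close> of paths satisfy the same
  recursion as the coefficients of \<open>ln (1 + x)\<close>.\<close>

lemma phi_path_graph:
  assumes "rooted_tree (path_graph p a b)" "inj_on p {a..<b}" "a < b"
  shows "phi (path_graph p a b) = fps_nth (fps_ln 1) (b - a)"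
  using assms
proof (induction "b - a" arbitrary: a b rule: less_induct)
  case less
  let ?P = "path_graph p a b"
  have card: "card (verts ?P) = b - a" by (simp add: path_graph_def card_image less.prems)
  show ?case
  proof (cases "b - a = 1")
    case True
    thus ?thesis using card by (simp add: phi_singleton fps_ln_nth)
  next
    case False
    hence two: "b - a \<ge> 2" using less.prems(3) by simp
    \<comment> \<open>\<open>cut_sum_path_graph\<close> needs at least one cut; with \<open>k - 1 = Suc (k - 2)\<close> cuts the exponent is \<open>k\<close>.\<close>
    have "cut_sum ?P (k - 1) = fps_nth (fps_ln 1 ^ k) (b - a)" if "k \<in> {2..b - a}" for k
      using cut_sum_path_graph[OF less.prems less.hyps, of "k - 2"] that
      by (simp add: Suc_diff_Suc numeral_2_eq_2 del: power_Suc)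
    thus ?thesis
      using two by (simp add: phi_cut_sum less.prems card fps_ln_power_sum)
  qed
qed

lemma phi_chain:
  assumes "is_chain n T" "n \<ge> 1"
  shows "phi T = fps_nth (fps_ln 1) n"
proof -
  obtain p where p: "inj_on p {0..<n}" "T = path_graph p 0 n"
    using chain_is_path_graph[OF assms] .
  thus ?thesis using phi_path_graph[of p 0 n] assms by (auto simp: is_chain_def)
qed

section \<open>Shrubs\<close>

definition star_graph :: "'a \<Rightarrow> 'a set \<Rightarrow> 'a rooted_graph" where
  "star_graph r V = Rooted_Graph (insert r V) ((\<lambda>w. {r, w}) ` V) r"

text \<open>Every vertex other than the root is adjacent to the root, so an edge avoiding the root would
  close a triangle.\<close>

lemma shrub_is_star_graph:
  assumes "is_shrub n T"
  shows "T = star_graph (root T) (verts T - {root T})"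
proof -
  let ?r = "root T" and ?V = "verts T - {root T}"
  have T: "rooted_tree T" and star: "\<And>w. w \<in> ?V \<Longrightarrow> {?r, w} \<in> edges T"
    using assms by (auto simp: is_shrub_def)
  have "e \<in> (\<lambda>w. {?r, w}) ` ?V" if e: "e \<in> edges T" for e
  proof -
    have "card e = 2" and sub: "e \<subseteq> verts T" using T e by (auto simp: rooted_tree_def)
    then obtain u w where uw: "e = {u, w}" "u \<noteq> w" by (auto simp: card_2_iff)
    have "u = ?r \<or> w = ?r"
    proof (rule ccontr)
      assume "\<not> (u = ?r \<or> w = ?r)"
      hence dist: "distinct [?r, u, w]" and V: "u \<in> ?V" "w \<in> ?V" using uw sub by auto
      have tri: "{?r, u} \<in> edges T" "{u, w} \<in> edges T" "{w, ?r} \<in> edges T"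
        using star[OF V(1)] star[OF V(2)] uw(1) e by (simp_all add: insert_commute)
      have "{[?r, u, w] ! i, [?r, u, w] ! (Suc i mod length [?r, u, w])} \<in> edges T"
        if "i < length [?r, u, w]" for i
      proof -
        have "i = 0 \<or> i = 1 \<or> i = 2" using that by auto
        thus ?thesis using tri by (elim disjE) simp_all
      qed
      with dist have "is_cycle (edges T) [?r, u, w]" by (simp add: is_cycle_def)
      thus False using T by (auto simp: rooted_tree_def)
    qed
    thus ?thesis using uw sub by auto
  qed
  moreover have "?r \<in> verts T" using T by (simp add: rooted_tree_def)
  ultimately show ?thesis
    using star by (cases T) (auto simp: star_graph_def)
qed

text \<open>Once its only edge is removed, a leaf is isolated; all other leaves keep their edge to the centre.\<close>

lemma component_star_graph:
  assumes "r \<notin> V" "w \<in> V"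
  shows "component_minus (star_graph r V) {r, w} r = star_graph r (V - {w})"
    and "component_minus (star_graph r V) {r, w} w = star_graph w {}"
proof -
  let ?T = "star_graph r V" and ?E = "(\<lambda>v. {r, v}) ` (V - {w})"
  have rw: "r \<noteq> w" using assms by blast
  have "inj_on (\<lambda>v. {r, v}) V" by (auto simp: inj_on_def doubleton_eq_iff)
  hence E: "edges ?T - {{r, w}} = ?E"
    using inj_on_image_set_diff[of "\<lambda>v. {r, v}" V V "{w}"] assms(2) by (simp add: star_graph_def)
  have R: "x = r \<and> y \<in> V - {w} \<or> y = r \<and> x \<in> V - {w}" if "(x, y) \<in> adj ?E" for x y
  proof -
    obtain v where "{x, y} = {r, v}" "v \<in> V - {w}" using \<open>(x, y) \<in> adj ?E\<close> by (auto simp: adj_def)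
    thus ?thesis by (auto simp: doubleton_eq_iff)
  qed
  have "y \<in> insert r (V - {w})" if "(r, y) \<in> (adj ?E)\<^sup>*" for y
    using that by (induction rule: rtrancl_induct) (use R in blast)+
  moreover have "(r, y) \<in> adj ?E" if "y \<in> V - {w}" for y
    using that by (auto simp: adj_def)
  ultimately have V: "{y \<in> verts ?T. (r, y) \<in> (adj ?E)\<^sup>*} = insert r (V - {w})"
    by (auto simp: star_graph_def)
  have F: "{f \<in> ?E. f \<subseteq> insert r (V - {w})} = ?E" by blast
  show "component_minus ?T {r, w} r = star_graph r (V - {w})"
    unfolding component_minus_def Let_def E V F by (simp only: star_graph_def)
  have "y = w" if "(w, y) \<in> (adj ?E)\<^sup>*" for y
    using that by (induction rule: rtrancl_induct) (use R rw in blast)+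
  hence W: "{y \<in> verts ?T. (w, y) \<in> (adj ?E)\<^sup>*} = {w}"
    using assms by (auto simp: star_graph_def)
  have G: "{f \<in> ?E. f \<subseteq> {w}} = {}" using rw by blast
  show "component_minus ?T {r, w} w = star_graph w {}"
    unfolding component_minus_def Let_def E W G by (simp only: star_graph_def image_empty)
qed

lemma lower_star_graph:
  "r \<notin> V \<Longrightarrow> w \<in> V \<Longrightarrow> lower (star_graph r V) {r, w} = star_graph r (V - {w})"
  unfolding lower_def using component_star_graph(1)[of r V w]
  by (metis rooted_graph.sel(3) star_graph_def)

lemma upper_star_graph:
  assumes "rooted_tree (star_graph r V)" "r \<notin> V" "w \<in> V"
  shows "upper (star_graph r V) {r, w} = star_graph w {}"
proof -
  let ?T = "star_graph r V"
  have "depth ?T r = 0"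
    using depth_le[of ?T r 0] by (simp add: star_graph_def)
  moreover have "depth ?T w \<noteq> 0"
    using relpow_depth[OF assms(1), of w] assms(2,3) by (auto simp: star_graph_def intro!: gr0I)
  ultimately have "far_end ?T {r, w} = w"
    using assms by (intro far_end_eq) (auto simp: star_graph_def)
  thus ?thesis using component_star_graph(2)[OF assms(2,3)] by (simp add: upper_def)
qed

lemma cut_sum_star_graph_Suc:
  assumes "rooted_tree (star_graph r V)" "r \<notin> V"
  shows "cut_sum (star_graph r V) (Suc k) = (\<Sum>w\<in>V. cut_sum (star_graph r (V - {w})) k)"
proof -
  have "inj_on (\<lambda>w. {r, w}) V" by (auto simp: inj_on_def doubleton_eq_iff)
  moreover have "edges (star_graph r V) = (\<lambda>w. {r, w}) ` V" by (simp add: star_graph_def)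
  moreover have "phi (star_graph w {}) = 1" for w :: 'a
    by (rule phi_singleton) (simp add: star_graph_def)
  ultimately show ?thesis
    using assms by (simp add: cut_sum_Suc sum.reindex lower_star_graph upper_star_graph)
qed

text \<open>Each cut chooses one of the remaining leaves. The number of choices turns \<open>(n - 1)!\<close> into
  \<open>n!\<close>, and the drop in size is the index shift by a factor \<open>fps_X\<close>; when no leaf remains, both sides
  are \<open>0\<close>. As for paths, \<open>phi\<close> is assumed to be known on smaller stars only.\<close>

lemma cut_sum_star_graph:
  assumes "rooted_tree (star_graph r V)" "r \<notin> V"
    and phi: "\<And>U. rooted_tree (star_graph r U) \<Longrightarrow> U \<subset> V \<Longrightarrow>
      phi (star_graph r U) = fact (card U) * fps_nth B (card U)"
  shows "cut_sum (star_graph r V) (Suc k) = fact (card V) * fps_nth (fps_X ^ Suc k * B) (card V)"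
  using assms
proof (induction k arbitrary: V)
  \<comment> \<open>Shared by base case and induction step, as for paths.\<close>
  have step: "cut_sum (star_graph r V) (Suc k) =
      fact (card V) * fps_nth (fps_X ^ Suc k * B) (card V)"
    if T: "rooted_tree (star_graph r V)" and r: "r \<notin> V"
    and lower: "\<And>w. w \<in> V \<Longrightarrow> rooted_tree (star_graph r (V - {w})) \<Longrightarrow>
      cut_sum (star_graph r (V - {w})) k =
      fact (card (V - {w})) * fps_nth (fps_X ^ k * B) (card (V - {w}))" for V k
  proof -
    have fin: "finite V" using T by (simp add: rooted_tree_def star_graph_def)
    have "cut_sum (star_graph r (V - {w})) k =
        fact (card V - 1) * fps_nth (fps_X ^ k * B) (card V - 1)" if w: "w \<in> V" for w
      using lower[OF w] rooted_tree_lower[OF T, of "{r, w}"] lower_star_graph[OF r w] w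
      by simp
    hence "cut_sum (star_graph r V) (Suc k) =
        of_nat (card V) * (fact (card V - 1) * fps_nth (fps_X ^ k * B) (card V - 1))"
      by (simp add: cut_sum_star_graph_Suc[OF T r])
    also have "\<dots> = fact (card V) * fps_nth (fps_X ^ Suc k * B) (card V)"
      by (cases "card V") (simp_all add: mult.assoc)
    finally show ?thesis .
  qed
  {
    case 0
    show ?case
    proof (rule step[OF 0(1,2)])
      fix w assume w: "w \<in> V" "rooted_tree (star_graph r (V - {w}))"
      have "V - {w} \<subset> V" using w(1) by blast
      from 0(3)[OF w(2) this]
      show "cut_sum (star_graph r (V - {w})) 0 =
          fact (card (V - {w})) * fps_nth (fps_X ^ 0 * B) (card (V - {w}))"
        by (simp only: cut_sum_0 power_0 mult_1)
    qed
  next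
    case (Suc k)
    show ?case
    proof (rule step[OF Suc.prems(1,2)])
      fix w assume w: "w \<in> V" "rooted_tree (star_graph r (V - {w}))"
      show "cut_sum (star_graph r (V - {w})) (Suc k) =
          fact (card (V - {w})) * fps_nth (fps_X ^ Suc k * B) (card (V - {w}))"
        by (rule Suc.IH[OF w(2)]) (use w Suc.prems(2,3) in auto)
    qed
  }
qed

text \<open>The division is exact, since \<open>e\<^sup>x - 1\<close> has order \<open>1\<close>.\<close>

lemma bernoulli_fps_eq: "fps_X / (fps_exp 1 - 1) * (fps_exp 1 - 1) = (fps_X :: rat fps)"
proof -
  let ?E = "fps_exp 1 - 1 :: rat fps"
  have "?E \<noteq> 0" by (auto simp: fps_eq_iff intro!: exI[of _ 1])
  moreover have "subdegree ?E = 1" by (rule subdegreeI) auto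
  ultimately have "?E dvd fps_X" by (simp add: fps_dvd_iff)
  thus ?thesis by simp
qed

text \<open>The recursion for shrubs as an identity of coefficients: this is degree \<open>n + 1\<close> of
  \<open>(e\<^sup>x - 1) B = x\<close>, with the term of \<open>B\<^sub>n\<close> isolated.\<close>

lemma bernoulli_fps_power_sum:
  fixes B :: "rat fps"
  defines "B \<equiv> fps_X / (fps_exp 1 - 1)"
  assumes "n \<ge> 1"
  shows "fps_nth B n = - (\<Sum>k=2..Suc n. fps_nth (fps_X ^ (k - 1) * B) n / fact k)"
proof -
  have "0 = fps_nth ((fps_exp 1 - 1) * B) (Suc n)"
    using assms bernoulli_fps_eq by (simp add: mult.commute)
  also have "\<dots> = (\<Sum>k=0..Suc n. fps_nth (fps_exp 1 - 1) k * fps_nth B (Suc n - k))"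
    by (rule fps_mult_nth)
  also have "\<dots> = (\<Sum>k=1..Suc n. fps_nth (fps_X ^ (k - 1) * B) n / fact k)"
    by (rule sum.mono_neutral_cong_right) (auto simp: fps_X_power_mult_nth Suc_diff_le)
  also have "\<dots> = fps_nth B n + (\<Sum>k=2..Suc n. fps_nth (fps_X ^ (k - 1) * B) n / fact k)"
    by (subst sum.atLeast_Suc_atMost) (auto simp: numeral_2_eq_2)
  finally show ?thesis by simp
qed

lemma bernoulli_num_0: "bernoulli_num 0 = 1"
proof -
  have "fps_nth (fps_X / (fps_exp 1 - 1) * (fps_exp 1 - 1)) 1 = (1 :: rat)"
    by (simp only: bernoulli_fps_eq) simp
  thus ?thesis by (simp add: bernoulli_num_def fps_mult_nth)
qed

text \<open>By strong induction on the set of leaves, the numbers \<open>phi\<close> of stars satisfy the same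
  recursion as the Bernoulli numbers.\<close>

lemma phi_star_graph:
  assumes "rooted_tree (star_graph r V)" "r \<notin> V"
  shows "phi (star_graph r V) = bernoulli_num (card V)"
proof -
  have "finite V" using assms by (simp add: rooted_tree_def star_graph_def)
  thus ?thesis using assms
  proof (induction V rule: finite_psubset_induct)
    case (psubset V)
    let ?T = "star_graph r V" and ?B = "fps_X / (fps_exp 1 - 1) :: rat fps"
    have card: "card (verts ?T) = Suc (card V)"
      using psubset by (simp add: star_graph_def)
    show ?case
    proof (cases "V = {}")
      case True
      thus ?thesis using card by (simp add: phi_singleton bernoulli_num_0)
    next
      case False
      hence one: "card V \<ge> 1" using psubset(1) by (simp add: Suc_le_eq card_gt_0_iff)
      have "cut_sum ?T (k - 1) = fact (card V) * fps_nth (fps_X ^ (k - 1) * ?B) (card V)"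
        if "k \<in> {2..Suc (card V)}" for k
      proof -
        have "k - 1 = Suc (k - 2)" using that by auto
        moreover have "phi (star_graph r U) = fact (card U) * fps_nth ?B (card U)"
          if "rooted_tree (star_graph r U)" "U \<subset> V" for U
          using psubset.IH[OF that(2,1)] that(2) psubset.prems
          by (auto simp: bernoulli_num_def)
        ultimately show ?thesis
          using cut_sum_star_graph[OF psubset.prems, of ?B "k - 2"] by simp
      qed
      hence "phi ?T = - (\<Sum>k=2..Suc (card V).
          fact (card V) * (fps_nth (fps_X ^ (k - 1) * ?B) (card V) / fact k))"
        using one by (simp add: phi_cut_sum psubset.prems card)
      also have "\<dots> = fact (card V) * fps_nth ?B (card V)"
        unfolding bernoulli_fps_power_sum[OF one] by (simp only: sum_distrib_left mult_minus_right)
      finally show ?thesis by (simp add: bernoulli_num_def)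
    qed
  qed
qed

lemma phi_shrub:
  assumes "is_shrub n T"
  shows "phi T = bernoulli_num n"
proof -
  let ?V = "verts T - {root T}"
  have T: "T = star_graph (root T) ?V" by (rule shrub_is_star_graph[OF assms])
  have "rooted_tree (star_graph (root T) ?V)" using assms T by (simp add: is_shrub_def)
  hence "phi (star_graph (root T) ?V) = bernoulli_num (card ?V)" by (rule phi_star_graph) simp
  moreover have "card ?V = n" using assms by (simp add: is_shrub_def rooted_tree_def)
  ultimately show ?thesis using T by simp
qed

theorem corollary3p5:
  fixes C :: "nat \<Rightarrow> 'a rooted_graph" and S :: "nat \<Rightarrow> 'b rooted_graph"
  assumes C: "\<And>n. n \<ge> 1 \<Longrightarrow> is_chain n (C n)"
    and S: "\<And>n. is_shrub n (S n)"
  shows "Abs_fps (\<lambda>n. if n = 0 then 0 else phi (C n)) = fps_ln 1 \<and>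
    Abs_fps (\<lambda>n. phi (S n) / fact n) = fps_X / (fps_exp 1 - 1) \<and>
    (\<forall>n\<ge>1. phi (C n) = (-1) ^ (n - 1) * (1 / of_nat n)) \<and>
    (\<forall>n. phi (S n) = bernoulli_num n)"
proof -
  have chain: "phi (C n) = fps_nth (fps_ln 1) n" if "n \<ge> 1" for n
    using phi_chain[OF C[OF that] that] .
  have shrub: "phi (S n) = bernoulli_num n" for n
    using phi_shrub[OF S] .
  have "Abs_fps (\<lambda>n. if n = 0 then 0 else phi (C n)) = fps_ln 1"
    by (rule fps_ext) (simp add: chain)
  moreover have "Abs_fps (\<lambda>n. phi (S n) / fact n) = fps_X / (fps_exp 1 - 1)"
    by (simp add: shrub bernoulli_num_egf)
  ultimately show ?thesis
    by (simp add: chain shrub fps_ln_nth)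
qed

end
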